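(* Let $k \neq l$ be elements of $V$, let $\mathcal{E}_{kl} = \{T\in\mathcal{T} : \{k,l\}\in E_T\}$, and let $p^0_{kl} = \xi(\mathcal{E}_{kl})$ and $p_{kl} = \xi(\mathcal{E}_{kl}|D)$ be the prior and posterior probabilities of the event $\mathcal{E}_{kl}$ under the tree model with prior $\xi$, with $0 < p^0_{kl} < 1$. Let $\lambda_{kl}\in[0,1]$, and consider the modified model in which $\epsilon_{kl}$ is a Bernoulli variable with $P(\epsilon_{kl} = 1) = \lambda_{kl}$; conditionally on $\epsilon_{kl}$, the random tree $T^*$ is drawn from $\xi(\cdot|\mathcal{E}_{kl})$ if $\epsilon_{kl} = 1$ and from $\xi(\cdot|\overline{\mathcal{E}}_{kl})$ if $\epsilon_{kl} = 0$ (where $\overline{\mathcal{E}}_{kl}$ is the complement of $\mathcal{E}_{kl}$ in $\mathcal{T}$); and, conditionally on $T^* = T$, the data $D$ is independent of $\epsilon_{kl}$ with likelihood $p(D|T)$. Then the posterior probability of $\{\epsilon_{kl} = 1\}$ in the modified model is $$P(\epsilon_{kl} = 1|D) = \lambda_{kl}\frac{p_{kl}}{p^0_{kl}}\cdot\left[\lambda_{kl}\frac{p_{kl}}{p^0_{kl}} + (1-\lambda_{kl})\frac{1-p_{kl}}{1-p^0_{kl}}\right]^{-1}.$$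
   Context: Let $V = \{1,\dots,p\}$, let $\mathcal{T}$ be the set of spanning trees on $V$ (connected acyclic undirected graphs with vertex set $V$), and write $E_T$ for the edge set of $T\in\mathcal{T}$. The prior on trees is $\xi(T) = \frac{1}{Z_0}\prod_{\{i,j\}\in E_T}\beta_{ij}$, where $\beta$ is a symmetric matrix with non-negative entries such that the graph on $V$ with edge set $\{\{i,j\} : i\neq j,\ \beta_{ij} > 0\}$ is connected, and $Z_0$ is a normalising constant. $D$ denotes the observed data and $p(D|T) > 0$ its marginal likelihood given the tree $T\in\mathcal{T}$. The posterior distribution in the original model is $\xi(T|D) = \xi(T)p(D|T)/\sum_{T'\in\mathcal{T}}\xi(T')p(D|T')$. For a set $\mathcal{A}\subseteq\mathcal{T}$, $\xi(\mathcal{A}) = \sum_{T\in\mathcal{A}}\xi(T)$, $\xi(\mathcal{A}|D) = \sum_{T\in\mathcal{A}}\xi(T|D)$, and $\xi(\cdot|\mathcal{A})$ denotes the prior $\xi$ conditioned on $\mathcal{A}$. *)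

theory Defs
  imports "HOL-Probability.Probability"
begin

section \<open>Undirected graphs and spanning trees\<close>

text \<open>
  A simple undirected graph on a fixed vertex set is identified with its set of edges, an edge
  being an unordered pair \<open>{u, v}\<close> of distinct vertices.
\<close>

type_synonym 'a edges = "'a set set"

definition all_edges :: "'a set \<Rightarrow> 'a edges" where
  "all_edges V = {{u, v} |u v. u \<in> V \<and> v \<in> V \<and> u \<noteq> v}"

definition connected_graph :: "'a set \<Rightarrow> 'a edges \<Rightarrow> bool" where
  "connected_graph V E \<longleftrightarrow> (\<forall>u\<in>V. \<forall>v\<in>V. (u, v) \<in> {(x, y). {x, y} \<in> E}\<^sup>*)"

definition is_cycle :: "'a edges \<Rightarrow> 'a list \<Rightarrow> bool" where
  "is_cycle E vs \<longleftrightarrow> length vs \<ge> 3 \<and> distinct vs \<and>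
     (\<forall>i<length vs. {vs ! i, vs ! (Suc i mod length vs)} \<in> E)"

definition acyclic_graph :: "'a edges \<Rightarrow> bool" where
  "acyclic_graph E \<longleftrightarrow> (\<nexists>vs. is_cycle E vs)"

definition spanning_trees :: "'a set \<Rightarrow> 'a edges set" where
  "spanning_trees V = {T. T \<subseteq> all_edges V \<and> connected_graph V T \<and> acyclic_graph T}"


section \<open>The tree prior\<close>

definition tree_weight :: "(nat \<Rightarrow> nat \<Rightarrow> real) \<Rightarrow> nat edges \<Rightarrow> real" where
  "tree_weight \<beta> T = (\<Prod>(i, j)\<in>{(i, j). i < j \<and> {i, j} \<in> T}. \<beta> i j)"

definition tree_norm :: "nat \<Rightarrow> (nat \<Rightarrow> nat \<Rightarrow> real) \<Rightarrow> real" where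
  "tree_norm p \<beta> = (\<Sum>T\<in>spanning_trees {1..p}. tree_weight \<beta> T)"

definition positive_graph :: "nat \<Rightarrow> (nat \<Rightarrow> nat \<Rightarrow> real) \<Rightarrow> nat edges" where
  "positive_graph p \<beta> = {{i, j} |i j. i \<in> {1..p} \<and> j \<in> {1..p} \<and> i \<noteq> j \<and> \<beta> i j > 0}"

definition valid_weights :: "nat \<Rightarrow> (nat \<Rightarrow> nat \<Rightarrow> real) \<Rightarrow> bool" where
  "valid_weights p \<beta> \<longleftrightarrow>
     (\<forall>i\<in>{1..p}. \<forall>j\<in>{1..p}. \<beta> i j = \<beta> j i \<and> \<beta> i j \<ge> 0) \<and>
     connected_graph {1..p} (positive_graph p \<beta>)"

text \<open>
  The argument of \<^const>\<open>embed_pmf\<close> is a probability mass function whenever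
  \<^const>\<open>valid_weights\<close> holds; see \<open>pmf_tree_prior\<close> below.
\<close>

definition tree_prior :: "nat \<Rightarrow> (nat \<Rightarrow> nat \<Rightarrow> real) \<Rightarrow> nat edges pmf" where
  "tree_prior p \<beta> = embed_pmf (\<lambda>T.
     if T \<in> spanning_trees {1..p} then 1 / tree_norm p \<beta> * tree_weight \<beta> T else 0)"


section \<open>Posterior distributions\<close>

text \<open>
  Bayes' formula for a discrete prior and the likelihood \<open>lik\<close> of the observed data as a function
  of the unobserved quantity; the normalising constant is the marginal likelihood of the data.
\<close>

definition posterior :: "'a pmf \<Rightarrow> ('a \<Rightarrow> real) \<Rightarrow> 'a pmf" where
  "posterior prior lik =
     embed_pmf (\<lambda>x. pmf prior x * lik x / measure_pmf.expectation prior lik)"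


section \<open>The edge event and the modified model\<close>

definition edge_event :: "nat \<Rightarrow> nat \<Rightarrow> nat \<Rightarrow> nat edges set" where
  "edge_event p k l = {T \<in> spanning_trees {1..p}. {k, l} \<in> T}"

text \<open>The joint law of \<open>(\<epsilon>, T\<^sup>*)\<close> before the data is observed.\<close>

definition modified_prior ::
  "nat \<Rightarrow> (nat \<Rightarrow> nat \<Rightarrow> real) \<Rightarrow> nat \<Rightarrow> nat \<Rightarrow> real \<Rightarrow> (bool \<times> nat edges) pmf" where
  "modified_prior p \<beta> k l lam =
     bind_pmf (bernoulli_pmf lam) (\<lambda>\<epsilon>.
     bind_pmf (cond_pmf (tree_prior p \<beta>)
       (if \<epsilon> then edge_event p k l else spanning_trees {1..p} - edge_event p k l)) (\<lambda>T.
     return_pmf (\<epsilon>, T)))"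

text \<open>Given \<open>T\<^sup>* = T\<close>, the likelihood does not depend on \<open>\<epsilon>\<close>.\<close>

definition modified_likelihood :: "(nat edges \<Rightarrow> real) \<Rightarrow> bool \<times> nat edges \<Rightarrow> real" where
  "modified_likelihood lik = (\<lambda>(\<epsilon>, T). lik T)"


section \<open>Well-definedness of the prior and the posterior\<close>

lemma finite_all_edges: "finite V \<Longrightarrow> finite (all_edges V)"
  by (rule finite_subset[of _ "Pow V"]) (auto simp: all_edges_def)

lemma finite_spanning_trees: "finite V \<Longrightarrow> finite (spanning_trees V)"
  by (rule finite_subset[of _ "Pow (all_edges V)"])
     (auto simp: spanning_trees_def finite_all_edges)

lemma connected_graph_remove_cycle_edge:
  assumes conn: "connected_graph V E" and cyc: "is_cycle E vs"
  shows "\<exists>e\<in>E. connected_graph V (E - {e})"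
proof -
  define n where "n = length vs"
  have n3: "n \<ge> 3" and dist: "distinct vs"
    and ed: "\<And>i. i < n \<Longrightarrow> {vs ! i, vs ! (Suc i mod n)} \<in> E"
    using cyc by (auto simp: is_cycle_def n_def)
  have nth_eq: "vs ! a = vs ! b \<longleftrightarrow> a = b" if "a < n" "b < n" for a b
    using that dist by (simp add: nth_eq_iff_index_eq n_def)
  define e where "e = {vs ! (n - 1), vs ! 0}"
  define R where "R = {(x, y). {x, y} \<in> E - {e}}"
  have eE: "e \<in> E"
    using ed[of "n - 1"] n3 by (simp add: e_def)
  have symR: "sym (R\<^sup>*)"
    by (rule sym_rtrancl) (auto simp: R_def sym_def insert_commute)
  have path: "(vs ! 0, vs ! i) \<in> R\<^sup>*" if "i < n" for i
    using that
  proof (induction i)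
    case (Suc i)
    have "{vs ! i, vs ! Suc i} \<in> E"
      using ed[of i] Suc.prems by simp
    moreover have "{vs ! i, vs ! Suc i} \<noteq> e"
    proof
      assume "{vs ! i, vs ! Suc i} = e"
      then have "vs ! Suc i = vs ! 0 \<or> vs ! i = vs ! 0"
        by (auto simp: e_def doubleton_eq_iff)
      then have i0: "i = 0"
        using nth_eq[of "Suc i" 0] nth_eq[of i 0] Suc.prems by auto
      with \<open>{vs ! i, vs ! Suc i} = e\<close> have "vs ! 1 = vs ! (n - 1)"
        by (auto simp: e_def doubleton_eq_iff)
      then show False
        using nth_eq[of 1 "n - 1"] n3 by simp
    qed
    ultimately have "(vs ! i, vs ! Suc i) \<in> R"
      by (auto simp: R_def)
    with Suc show ?case
      by (meson Suc_lessD rtrancl.rtrancl_into_rtrancl)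
  qed simp
  have p1: "(vs ! 0, vs ! (n - 1)) \<in> R\<^sup>*"
    using path n3 by simp
  have p2: "(vs ! (n - 1), vs ! 0) \<in> R\<^sup>*"
    using p1 symR by (meson symD)
  have "{(x, y). {x, y} \<in> E} \<subseteq> R\<^sup>*"
  proof clarify
    fix x y assume xy: "{x, y} \<in> E"
    show "(x, y) \<in> R\<^sup>*"
    proof (cases "{x, y} = e")
      case True
      then show ?thesis
        using p1 p2 by (auto simp: e_def doubleton_eq_iff)
    next
      case False
      then show ?thesis
        using xy by (auto simp: R_def)
    qed
  qed
  then have "{(x, y). {x, y} \<in> E}\<^sup>* \<subseteq> R\<^sup>*"
    by (metis rtrancl_idemp rtrancl_mono)
  then have "connected_graph V (E - {e})"
    using conn by (auto simp: connected_graph_def R_def)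
  with eE show ?thesis
    by blast
qed

lemma exists_spanning_tree:
  assumes "finite V" "E \<subseteq> all_edges V" "connected_graph V E"
  shows "\<exists>T\<in>spanning_trees V. T \<subseteq> E"
proof -
  define P where "P F \<longleftrightarrow> F \<subseteq> E \<and> connected_graph V F" for F
  have "P E"
    using assms by (simp add: P_def)
  then obtain T where T: "P T" and min: "\<And>F. P F \<Longrightarrow> card T \<le> card F"
    using ex_has_least_nat[of P E card] by blast
  have finT: "finite T"
    using T assms finite_all_edges by (metis P_def finite_subset)
  have "acyclic_graph T"
    unfolding acyclic_graph_def
  proof
    assume "\<exists>vs. is_cycle T vs"
    then obtain e where e: "e \<in> T" "connected_graph V (T - {e})"
      using connected_graph_remove_cycle_edge T by (metis P_def)
    then have "P (T - {e})"
      using T by (auto simp: P_def)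
    from min[OF this] show False
      using e finT by (metis card_Diff1_less not_le)
  qed
  then show ?thesis
    using T assms by (auto simp: P_def spanning_trees_def)
qed

lemma tree_weight_nonneg:
  assumes "valid_weights p \<beta>" "T \<in> spanning_trees {1..p}"
  shows "tree_weight \<beta> T \<ge> 0"
  unfolding tree_weight_def
proof (rule prod_nonneg, clarify)
  fix i j assume "{i, j} \<in> T"
  then have "{i, j} \<in> all_edges {1..p}"
    using assms by (auto simp: spanning_trees_def)
  then have "i \<in> {1..p}" "j \<in> {1..p}"
    by (auto simp: all_edges_def doubleton_eq_iff)
  then show "\<beta> i j \<ge> 0"
    using assms by (auto simp: valid_weights_def)
qed

lemma tree_norm_pos:
  assumes "valid_weights p \<beta>"
  shows "tree_norm p \<beta> > 0"
proof -
  have "connected_graph {1..p} (positive_graph p \<beta>)"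
    using assms by (simp add: valid_weights_def)
  moreover have "positive_graph p \<beta> \<subseteq> all_edges {1..p}"
    by (auto simp: positive_graph_def all_edges_def)
  ultimately obtain T where T: "T \<in> spanning_trees {1..p}" "T \<subseteq> positive_graph p \<beta>"
    using exists_spanning_tree[of "{1..p}" "positive_graph p \<beta>"] by auto
  have "tree_weight \<beta> T > 0"
    unfolding tree_weight_def
  proof (rule prod_pos, clarify)
    fix i j assume "{i, j} \<in> T"
    then have "{i, j} \<in> positive_graph p \<beta>"
      using T by auto
    then show "\<beta> i j > 0"
      using assms by (auto simp: positive_graph_def valid_weights_def doubleton_eq_iff)
  qed
  then show ?thesis
    unfolding tree_norm_def
    using tree_weight_nonneg[OF assms] finite_spanning_trees[of "{1..p}"]
    by (intro sum_pos2[OF _ T(1)]) auto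
qed

lemma pmf_tree_prior:
  assumes "valid_weights p \<beta>"
  shows "pmf (tree_prior p \<beta>) T =
    (if T \<in> spanning_trees {1..p} then 1 / tree_norm p \<beta> * tree_weight \<beta> T else 0)"
proof -
  let ?f = "\<lambda>T. if T \<in> spanning_trees {1..p} then 1 / tree_norm p \<beta> * tree_weight \<beta> T else 0"
  have nn: "?f T \<ge> 0" for T
    using tree_norm_pos[OF assms] tree_weight_nonneg[OF assms] by simp
  have "(\<integral>\<^sup>+T. ennreal (?f T) \<partial>count_space UNIV) =
      (\<Sum>T\<in>spanning_trees {1..p}. ennreal (?f T))"
    by (rule nn_integral_count_space'[OF finite_spanning_trees]) auto
  also have "\<dots> = ennreal (\<Sum>T\<in>spanning_trees {1..p}. ?f T)"
    by (rule sum_ennreal) (rule nn)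
  also have "(\<Sum>T\<in>spanning_trees {1..p}. ?f T) = 1"
    using tree_norm_pos[OF assms]
    by (simp flip: sum_divide_distrib add: tree_norm_def)
  finally show ?thesis
    unfolding tree_prior_def by (intro pmf_embed_pmf nn) simp
qed

lemma pmf_posterior:
  assumes "finite (set_pmf prior)" and "\<And>x. x \<in> set_pmf prior \<Longrightarrow> lik x > 0"
  shows "pmf (posterior prior lik) x =
    pmf prior x * lik x / (\<Sum>y\<in>set_pmf prior. pmf prior y * lik y)"
proof -
  let ?S = "set_pmf prior"
  have ev: "measure_pmf.expectation prior lik = (\<Sum>y\<in>?S. pmf prior y * lik y)"
    using integral_measure_pmf_real[of ?S prior lik] assms(1) by (simp add: mult.commute)
  have pos: "(\<Sum>y\<in>?S. pmf prior y * lik y) > 0"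
    using assms by (intro sum_pos set_pmf_not_empty) (auto simp: pmf_positive)
  let ?f = "\<lambda>x. pmf prior x * lik x / measure_pmf.expectation prior lik"
  have nn: "?f x \<ge> 0" for x
    using assms(2)[of x] pos by (cases "x \<in> ?S") (auto simp: ev set_pmf_iff)
  have "(\<integral>\<^sup>+x. ennreal (?f x) \<partial>count_space UNIV) = (\<Sum>x\<in>?S. ennreal (?f x))"
    using assms(1) by (intro nn_integral_count_space') (auto simp: set_pmf_iff)
  also have "\<dots> = ennreal (\<Sum>x\<in>?S. ?f x)"
    using nn by (intro sum_ennreal) auto
  also have "(\<Sum>x\<in>?S. ?f x) = 1"
    using pos by (simp flip: sum_divide_distrib add: ev)
  finally have "pmf (posterior prior lik) x = ?f x"
    unfolding posterior_def by (intro pmf_embed_pmf nn) simp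
  then show ?thesis
    by (simp add: ev)
qed

end

theory Submission
  imports Defs
begin

text \<open>
  Let \<open>w(A)\<close> be the integral of the likelihood over \<open>A\<close> with respect to the tree prior. The two
  conditional priors give \<open>\<epsilon> = 1\<close> and \<open>\<epsilon> = 0\<close> the marginal likelihoods \<open>w(E) / p\<^sup>0\<close> and
  \<open>w(E\<^sup>c) / (1 - p\<^sup>0)\<close>; dividing both by \<open>w(E) + w(E\<^sup>c)\<close> turns \<open>w(E)\<close> into the posterior \<open>p\<close> and
  \<open>w(E\<^sup>c)\<close> into \<open>1 - p\<close>, and Bayes' formula for \<open>\<epsilon>\<close> is the claim.
\<close>

text \<open>Points outside the support have weight 0, so the sums may run over any finite superset
  \<open>F\<close>. This allows one fixed index set whatever zeros \<open>\<beta>\<close> or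
  \<open>lam\<close> produce.\<close>

lemma prob_posterior:
  assumes "finite F" and "set_pmf M \<subseteq> F"
    and "\<And>x. x \<in> set_pmf M \<Longrightarrow> f x > 0"
  shows "measure_pmf.prob (posterior M f) A =
    (\<Sum>x\<in>F \<inter> A. pmf M x * f x) / (\<Sum>x\<in>F. pmf M x * f x)"
proof -
  have fin: "finite (set_pmf M)"
    using assms finite_subset by blast
  have pmf: "pmf (posterior M f) x = pmf M x * f x / (\<Sum>x\<in>F. pmf M x * f x)" for x
  proof -
    have "(\<Sum>y\<in>set_pmf M. pmf M y * f y) = (\<Sum>x\<in>F. pmf M x * f x)"
      using assms by (intro sum.mono_neutral_left) (auto simp: set_pmf_iff)
    then show ?thesis
      using pmf_posterior[of M f x] fin assms(3) by simp
  qed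
  have "set_pmf (posterior M f) \<subseteq> F"
    using assms(2) by (auto simp: set_pmf_iff pmf)
  then have "measure_pmf.prob (posterior M f) A = measure_pmf.prob (posterior M f) (F \<inter> A)"
    by (intro measure_prob_cong_0) (auto simp: set_pmf_iff)
  also have "\<dots> = (\<Sum>x\<in>F \<inter> A. pmf (posterior M f) x)"
    using assms(1) by (intro measure_measure_pmf_finite) auto
  finally show ?thesis
    by (simp add: pmf sum_divide_distrib)
qed

text \<open>Conditioning restricts the mass to \<open>A\<close> and rescales it. For a likelihood
  \<open>f\<close>, and \<open>F\<close> covering the support, this is the marginal likelihood under
  the conditioned prior.\<close>

lemma sum_cond_pmf:
  fixes f :: "'a \<Rightarrow> real"
  assumes "finite F" and "measure_pmf.prob M A > 0"
  shows "(\<Sum>x\<in>F. pmf (cond_pmf M A) x * f x) =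
    (\<Sum>x\<in>F \<inter> A. pmf M x * f x) / measure_pmf.prob M A"
proof -
  have "set_pmf M \<inter> A \<noteq> {}"
    using assms(2) measure_pmf_zero_iff[of M A] by auto
  then have "(\<Sum>x\<in>F. pmf (cond_pmf M A) x * f x) =
      (\<Sum>x\<in>F. if x \<in> A then pmf M x * f x / measure_pmf.prob M A else 0)"
    by (intro sum.cong) (auto simp: pmf_cond)
  also have "\<dots> = (\<Sum>x\<in>F \<inter> A. pmf M x * f x / measure_pmf.prob M A)"
    using assms(1) by (rule sum.inter_restrict[symmetric])
  finally show ?thesis
    by (simp add: sum_divide_distrib)
qed

text \<open>Chain rule: only the branch that starts from \<open>e\<close> itself can produce a pair
  with first component \<open>e\<close>, and there \<open>Pair e\<close> is injective.\<close>

lemma pmf_dependent_pair: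
  "pmf (bind_pmf N (\<lambda>e. bind_pmf (K e) (\<lambda>x. return_pmf (e, x)))) (e, x) = pmf N e * pmf (K e) x"
proof -
  have "pmf (bind_pmf (K e') (\<lambda>x. return_pmf (e', x))) (e, x) = indicator {e} e' * pmf (K e) x"
    for e'
  proof (cases "e' = e")
    case True
    then show ?thesis
      using pmf_map_inj'[of "Pair e" "K e" x] by (simp add: map_pmf_def[symmetric] inj_def)
  next
    case False
    then show ?thesis
      by (auto simp: pmf_eq_0_set_pmf)
  qed
  then show ?thesis
    by (subst pmf_bind) (simp add: measure_pmf_single)
qed

theorem proposition7:
  fixes p k l :: nat
    and \<beta> :: "nat \<Rightarrow> nat \<Rightarrow> real"
    and lik :: "'d \<Rightarrow> nat edges \<Rightarrow> real"
    and D :: 'd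
    and lam pr0 pr :: real
  assumes "valid_weights p \<beta>"
    and "\<And>T. T \<in> spanning_trees {1..p} \<Longrightarrow> lik D T > 0"
    and "k \<in> {1..p}" and "l \<in> {1..p}" and "k \<noteq> l"
    and "pr0 = measure_pmf.prob (tree_prior p \<beta>) (edge_event p k l)"
    and "pr = measure_pmf.prob (posterior (tree_prior p \<beta>) (lik D)) (edge_event p k l)"
    and "0 < pr0" and "pr0 < 1"
    and "0 \<le> lam" and "lam \<le> 1"
  shows "measure_pmf.prob
           (posterior (modified_prior p \<beta> k l lam) (modified_likelihood (lik D)))
           {(\<epsilon>, T). \<epsilon> = True}
         = lam * (pr / pr0) *
           inverse (lam * (pr / pr0) + (1 - lam) * ((1 - pr) / (1 - pr0)))"
proof -
  \<comment> \<open>Otherwise the simplifier turns \<open>{1..p}\<close> into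
    \<open>{Suc 0..p}\<close>, which no longer matches the facts about spanning trees.\<close>
  note One_nat_def [simp del]
  let ?S = "spanning_trees {1..p}" and ?E = "edge_event p k l" and ?M = "tree_prior p \<beta>"
  let ?N = "modified_prior p \<beta> k l lam"
  define w where "w A = (\<Sum>T\<in>A. pmf ?M T * lik D T)" for A
  have fin: "finite ?S"
    by (simp add: finite_spanning_trees)
  have ES: "?S \<inter> ?E = ?E" "?S \<inter> (?S - ?E) = ?S - ?E" "?E \<subseteq> ?S"
    by (auto simp: edge_event_def)
  have M: "set_pmf ?M \<subseteq> ?S"
    using pmf_tree_prior[OF assms(1)] by (auto simp: set_pmf_iff split: if_splits)
  \<comment> \<open>\<open>- ?E\<close> also contains edge sets that are not spanning trees, but
    these are null for the prior.\<close>
  have "measure_pmf.prob ?M (?S - ?E) = measure_pmf.prob ?M (- ?E)"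
    using M by (intro measure_prob_cong_0) (auto simp: set_pmf_iff)
  then have pr0': "measure_pmf.prob ?M (?S - ?E) = 1 - pr0"
    using measure_pmf.prob_compl[of ?E ?M] by (simp add: assms(6) Compl_eq_Diff_UNIV)
  have w_split: "w ?S = w ?E + w (?S - ?E)"
    unfolding w_def using ES(3) fin by (subst sum.subset_diff[of ?E]) auto
  \<comment> \<open>Some spanning trees may have prior mass 0; on the support every summand is
    strictly positive.\<close>
  have "w ?S = (\<Sum>T\<in>set_pmf ?M. pmf ?M T * lik D T)"
    unfolding w_def using M fin by (intro sum.mono_neutral_right) (auto simp: set_pmf_iff)
  also have "\<dots> > 0"
    using M fin assms(2)
    by (intro sum_pos set_pmf_not_empty) (auto simp: pmf_positive intro: finite_subset)
  finally have w_pos: "w ?S > 0" .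
  have pr: "pr = w ?E / w ?S"
    unfolding assms(7) w_def using M assms(2)
    by (subst prob_posterior[OF fin M]) (auto simp only: ES)
  then have pr': "1 - pr = w (?S - ?E) / w ?S"
    using w_pos unfolding pr w_split by (simp add: field_simps)

  define K where "K \<epsilon> = cond_pmf ?M (if \<epsilon> then ?E else ?S - ?E)" for \<epsilon>
  have N: "pmf ?N (\<epsilon>, T) = pmf (bernoulli_pmf lam) \<epsilon> * pmf (K \<epsilon>) T" for \<epsilon> T
    unfolding modified_prior_def K_def by (rule pmf_dependent_pair)
  have K: "set_pmf (K \<epsilon>) \<subseteq> ?S" for \<epsilon>
  proof -
    \<comment> \<open>Both conditioning events have positive mass because 0 < \<open>pr0\<close> <
      1.\<close>
    have "set_pmf ?M \<inter> (if \<epsilon> then ?E else ?S - ?E) \<noteq> {}"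
      using measure_pmf_zero_iff[of ?M ?E] measure_pmf_zero_iff[of ?M "?S - ?E"] pr0' assms(6,8,9)
      by auto
    then show ?thesis
      using M by (auto simp: K_def set_cond_pmf)
  qed
  \<comment> \<open>Both values of \<epsilon> are kept, so the degenerate cases
    \<open>lam = 0\<close> and \<open>lam = 1\<close> need no separate treatment.\<close>
  have NS: "set_pmf ?N \<subseteq> UNIV \<times> ?S"
    using K by (auto simp: set_pmf_iff N subset_iff)
  \<comment> \<open>This is the joint weight of \<epsilon> and the data, with the tree summed
    out.\<close>
  have sum_N: "(\<Sum>T\<in>?S. pmf ?N (\<epsilon>, T) * lik D T) =
      (if \<epsilon> then lam * (w ?E / pr0) else (1 - lam) * (w (?S - ?E) / (1 - pr0)))" for \<epsilon>
    using sum_cond_pmf[OF fin, of ?M ?E "lik D"] sum_cond_pmf[OF fin, of ?M "?S - ?E" "lik D"]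
      pr0' assms(6,8-11)
    by (simp add: N K_def ES w_def mult.assoc flip: sum_distrib_left)
  have "measure_pmf.prob (posterior ?N (modified_likelihood (lik D))) {(\<epsilon>, T). \<epsilon> = True} =
      (\<Sum>x\<in>(UNIV \<times> ?S) \<inter> {(\<epsilon>, T). \<epsilon> = True}. pmf ?N x * modified_likelihood (lik D) x) /
      (\<Sum>x\<in>UNIV \<times> ?S. pmf ?N x * modified_likelihood (lik D) x)"
    using fin NS assms(2) by (intro prob_posterior) (auto simp: modified_likelihood_def)
  also have "(UNIV \<times> ?S) \<inter> {(\<epsilon>, T). \<epsilon> = True} = {True} \<times> ?S"
    by auto
  also have "(\<Sum>x\<in>{True} \<times> ?S. pmf ?N x * modified_likelihood (lik D) x) = lam * (w ?E / pr0)"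
    using sum_N[of True] by (simp add: modified_likelihood_def sum.cartesian_product')
  also have "(\<Sum>x\<in>UNIV \<times> ?S. pmf ?N x * modified_likelihood (lik D) x) =
      lam * (w ?E / pr0) + (1 - lam) * (w (?S - ?E) / (1 - pr0))"
    using sum_N[of True] sum_N[of False]
    by (simp add: modified_likelihood_def UNIV_bool sum.cartesian_product' add.commute)
  also have "lam * (w ?E / pr0) / \<dots> = (lam * (w ?E / pr0) / w ?S) /
      ((lam * (w ?E / pr0) + (1 - lam) * (w (?S - ?E) / (1 - pr0))) / w ?S)"
    using w_pos by simp
  also have "\<dots> = lam * (pr / pr0) *
      inverse (lam * (pr / pr0) + (1 - lam) * ((1 - pr) / (1 - pr0)))"
    \<comment> \<open>The order matters: \<open>1 - pr\<close> has to be replaced before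
      \<open>pr\<close> itself is rewritten.\<close>
    unfolding pr' unfolding pr
    by (simp add: divide_inverse algebra_simps)
  finally show ?thesis .
qed

end
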